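(* Let $\alpha,\rho,\delta_n>0$, let $C_n\in\mathbb{R}^{m\times m}$ be a symmetric sample covariance matrix, and let $S^{(k)}\in\mathcal{S}$, $\Lambda^{(k)}\in\mathbb{R}^{m\times m}$, $\lambda_2^{(k)}\in\mathbb{R}^m$. Then the update $$(Z^{(k+1)},q^{(k+1)}):=\operatorname*{argmin}_{(Z,q)\in\mathbb{R}^{m\times m}\times\mathbb{R}^m}L(S^{(k)},Z,q,\Lambda^{(k)},\lambda_2^{(k)})$$ is given explicitly by $$Z^{(k+1)}=\min\Bigl\{1,\frac{\delta_n}{\|\tilde Z\|_F}\Bigr\}\tilde Z,\qquad q^{(k+1)}=\frac{\tilde q+\sqrt{\tilde q^2+(4\alpha/\rho)\mathbf{1}}}{2},$$ where $$\tilde Z=C_nS^{(k)}-S^{(k)}C_n+\frac{\Lambda^{(k)}}{\rho},\qquad \tilde q=S^{(k)}\mathbf{1}-\frac1\rho\lambda_2^{(k)},$$ and the square and square root of vectors are taken entrywise.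
   Context: $\mathcal{S}:=\{S\in\mathbb{R}^{m\times m}: S=S^\top,\ \operatorname{diag}(S)=0,\ S\ge 0 \text{ entrywise}\}$; $\iota_T$ denotes the indicator function of a set $T$ ($0$ on $T$, $+\infty$ off $T$); $\mathbb{B}(0,\delta)$ is the closed Frobenius-norm ball in $\mathbb{R}^{m\times m}$ of radius $\delta$ centred at $0$; $\langle X,Y\rangle=\operatorname{tr}(X^\top Y)$; $\mathbf{1}$ is the all-ones vector; $\log$ is entrywise, with $-\log t=+\infty$ for $t\le0$. When $\tilde Z=0$ the factor $\min\{1,\delta_n/\|\tilde Z\|_F\}$ is read as $1$. The augmented Lagrangian (with penalty parameter $\rho>0$) is $$\begin{aligned}L(S,Z,q,\Lambda,\lambda_2)=\ &\langle\mathbf{1}\mathbf{1}^\top,S\rangle-\alpha\mathbf{1}^\top\log q+\iota_{\mathcal{S}}(S)+\iota_{\mathbb{B}(0,\delta_n)}(Z)+\langle\Lambda,C_nS-SC_n-Z\rangle+\lambda_2^\top(q-S\mathbf{1})\\&+\frac\rho2\|C_nS-SC_n-Z\|_F^2+\frac\rho2\|q-S\mathbf{1}\|_2^2 .\end{aligned}$$ *)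

theory Defs
  imports "HOL-Analysis.Analysis"
begin

definition S_set :: "(real ^ 'm ^ 'm) set" where
  "S_set = {S. transpose S = S \<and> (\<forall>i. S $ i $ i = 0) \<and> (\<forall>i j. 0 \<le> S $ i $ j)}"

definition iota :: "'a set \<Rightarrow> 'a \<Rightarrow> ereal" where
  "iota T x = (if x \<in> T then 0 else \<infinity>)"

definition neg_log :: "real \<Rightarrow> ereal" where
  "neg_log t = (if 0 < t then ereal (- ln t) else \<infinity>)"

definition frob_inner :: "real ^ 'm ^ 'm \<Rightarrow> real ^ 'm ^ 'm \<Rightarrow> real" where
  "frob_inner X Y = trace (transpose X ** Y)"

(* The library norm on the type of matrices is the Frobenius norm, so that
   cball 0 \<delta> is the closed Frobenius ball. *)
lemma norm_eq_frobenius: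
  fixes X :: "real ^ 'm ^ 'm"
  shows "norm X = sqrt (\<Sum>i\<in>UNIV. \<Sum>j\<in>UNIV. (X $ i $ j)\<^sup>2)"
    and "norm X = sqrt (frob_inner X X)"
proof -
  show a: "norm X = sqrt (\<Sum>i\<in>UNIV. \<Sum>j\<in>UNIV. (X $ i $ j)\<^sup>2)"
    by (simp add: norm_vec_def L2_set_def sum_nonneg)
  have "frob_inner X X = (\<Sum>j\<in>UNIV. \<Sum>i\<in>UNIV. (X $ i $ j)\<^sup>2)"
    by (simp add: frob_inner_def trace_def transpose_def matrix_matrix_mult_def power2_eq_square)
  also have "\<dots> = (\<Sum>i\<in>UNIV. \<Sum>j\<in>UNIV. (X $ i $ j)\<^sup>2)"
    by (rule sum.swap)
  finally show "norm X = sqrt (frob_inner X X)"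
    using a by simp
qed

(* Extended-real valued; every summand is greater than -\<infinity> when \<alpha> > 0, so no
   undefined sum \<infinity> - \<infinity> occurs. The all-ones vector is (1 :: real ^ 'm), since the
   library defines 1 componentwise on vectors. *)
definition aug_lagrangian ::
  "real \<Rightarrow> real \<Rightarrow> real \<Rightarrow> real ^ 'm ^ 'm \<Rightarrow>
   real ^ 'm ^ 'm \<Rightarrow> real ^ 'm ^ 'm \<Rightarrow> real ^ 'm \<Rightarrow> real ^ 'm ^ 'm \<Rightarrow> real ^ 'm \<Rightarrow> ereal"
where
  "aug_lagrangian \<alpha> \<rho> \<delta> C S Z q \<Lambda> lam\<^sub>2 =
     ereal (frob_inner (\<chi> i j. 1) S)
   + ereal \<alpha> * (\<Sum>i\<in>UNIV. neg_log (q $ i))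
   + iota S_set S
   + iota (cball 0 \<delta>) Z
   + ereal (frob_inner \<Lambda> (C ** S - S ** C - Z))
   + ereal (lam\<^sub>2 \<bullet> (q - S *v 1))
   + ereal (\<rho> / 2 * (norm (C ** S - S ** C - Z))\<^sup>2)
   + ereal (\<rho> / 2 * (norm (q - S *v 1))\<^sup>2)"

end

theory Submission
  imports Defs
begin

text \<open>Completing the square in the terms involving \<open>Z\<close> and in those involving \<open>q\<close> turns the
  augmented Lagrangian, as a function of \<open>(Z, q)\<close>, into a constant plus
  \<open>\<rho>/2 \<parallel>Z - Zt\<parallel>\<^sup>2 + \<Sum>i. (\<rho>/2 (q\<^sub>i - qt\<^sub>i)\<^sup>2 - \<alpha> ln q\<^sub>i)\<close> on the set \<open>\<parallel>Z\<parallel> \<le> \<delta>\<close>, \<open>q > 0\<close>, and \<open>\<infinity>\<close>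
  elsewhere. The problem separates: the \<open>Z\<close>-part is the projection of \<open>Zt\<close> onto a ball, and each
  \<open>q\<^sub>i\<close>-part is a strongly convex scalar problem whose stationarity condition
  \<open>\<rho> t (t - qt\<^sub>i) = \<alpha>\<close> has the stated positive root. Both parts grow at least quadratically away
  from the minimizer, which gives uniqueness.\<close>

lemma frob_inner_eq_inner: "frob_inner X Y = X \<bullet> Y"
  unfolding frob_inner_def trace_def transpose_def matrix_matrix_mult_def inner_vec_def
  by (simp, rule sum.swap)

text \<open>With \<open>l\<close> a multiplier and \<open>x\<close> a constraint residual, this is
  the scaled form of an augmented Lagrangian: shifting by \<open>l\<close> over
  \<open>\<rho>\<close> absorbs the linear term.\<close>

lemma complete_square:
  fixes l x :: "'a::real_inner"
  assumes "\<rho> \<noteq> 0"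
  shows "l \<bullet> x + \<rho> / 2 * (norm x)\<^sup>2
    = \<rho> / 2 * (norm (x + (1 / \<rho>) *\<^sub>R l))\<^sup>2 - (norm l)\<^sup>2 / (2 * \<rho>)"
  using assms
  by (simp add: power2_norm_eq_inner inner_add_left inner_add_right inner_commute field_simps)

text \<open>The point \<open>p\<close> is the projection of \<open>x\<close> onto the ball. The
  segments from \<open>p\<close> to \<open>z\<close> and to \<open>x\<close> do not form an acute
  angle, so expanding \<open>(z - p) + (p - x)\<close> leaves a nonnegative cross term.\<close>

lemma ball_projection_growth:
  fixes x z :: "'a::real_inner"
  assumes "0 < \<delta>" and "norm z \<le> \<delta>"
  defines "p \<equiv> (if x = 0 then 1 else min 1 (\<delta> / norm x)) *\<^sub>R x"
  shows "(norm (p - x))\<^sup>2 + (norm (z - p))\<^sup>2 \<le> (norm (z - x))\<^sup>2"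
proof -
  have obtuse: "0 \<le> (z - p) \<bullet> (p - x)"
  proof (cases "norm x \<le> \<delta>")
    case True
    then have "p = x" by (auto simp: p_def min_def field_simps)
    then show ?thesis by simp
  next
    case False
    define c where "c = \<delta> / norm x"
    have nx: "0 < norm x" using False assms(1) by linarith
    then have c: "c < 1" and cx: "c * norm x = \<delta>" using False by (simp_all add: c_def)
    have p: "p = c *\<^sub>R x" using nx c by (auto simp: p_def c_def)
    \<comment> \<open>Cauchy-Schwarz bounds \<open>z \<bullet> x\<close> by
      \<open>c * (x \<bullet> x)\<close>; the cross term is their gap times
      \<open>1 - c\<close>.\<close>
    have "z \<bullet> x \<le> norm z * norm x" by (rule norm_cauchy_schwarz)
    also have "\<dots> \<le> \<delta> * norm x" using assms(2) by (simp add: mult_right_mono)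
    also have "\<dots> = c * (x \<bullet> x)"
      by (simp flip: cx power2_norm_eq_inner add: power2_eq_square)
    finally have "0 \<le> (1 - c) * (c * (x \<bullet> x) - z \<bullet> x)" using c by simp
    also have "\<dots> = (z - p) \<bullet> (p - x)"
      by (simp add: p inner_diff_left inner_diff_right inner_commute algebra_simps)
    finally show ?thesis .
  qed
  have "(norm (z - x))\<^sup>2 = (norm (p - x))\<^sup>2 + (norm (z - p))\<^sup>2 + 2 * ((z - p) \<bullet> (p - x))"
    by (simp add: power2_norm_eq_inner inner_diff_left inner_diff_right inner_commute)
  with obtuse show ?thesis by simp
qed

lemma norm_ball_projection:
  fixes x :: "'a::real_inner"
  assumes "0 < \<delta>"
  shows "norm ((if x = 0 then 1 else min 1 (\<delta> / norm x)) *\<^sub>R x) \<le> \<delta>"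
  using assms by (auto simp: min_def field_simps abs_if)

text \<open>This is the larger root of a quadratic, positive because the square root exceeds
  \<open>\<bar>c\<bar>\<close>.\<close>

lemma log_prox_root:
  fixes c d :: real
  assumes "0 < d"
  defines "s \<equiv> (c + sqrt (c\<^sup>2 + 4 * d)) / 2"
  shows "0 < s" and "s * (s - c) = d"
proof -
  have "\<bar>c\<bar> < sqrt (c\<^sup>2 + 4 * d)"
    using assms(1) by (intro real_less_rsqrt) simp
  then show "0 < s" by (simp add: s_def)
  have "(sqrt (c\<^sup>2 + 4 * d))\<^sup>2 = c\<^sup>2 + 4 * d" using assms(1) by simp
  then show "s * (s - c) = d" by (simp add: s_def field_simps power2_eq_square)
qed

text \<open>The logarithm lies below its tangent at \<open>s\<close>. By \<open>root\<close>, the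
  slope of that tangent times \<open>\<alpha>\<close> is \<open>\<rho> * (s - c)\<close>, which
  cancels the linear term of the quadratic expanded at \<open>s\<close>.\<close>

lemma log_prox_growth:
  fixes \<alpha> \<rho> c s t :: real
  assumes "0 < \<alpha>" and "0 < s" and "0 < t" and root: "\<rho> * (s * (s - c)) = \<alpha>"
  shows "\<rho> / 2 * (s - c)\<^sup>2 - \<alpha> * ln s + \<rho> / 2 * (t - s)\<^sup>2 \<le> \<rho> / 2 * (t - c)\<^sup>2 - \<alpha> * ln t"
proof -
  have "ln t - ln s = ln (t / s)" using assms by (simp add: ln_div)
  also have "\<dots> \<le> t / s - 1" using assms by (intro ln_le_minus_one) simp
  finally have "\<alpha> * (ln t - ln s) \<le> \<alpha> * (t / s - 1)" using assms(1) by simp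
  also have "\<dots> = \<rho> * (s - c) * (t - s)"
    using assms(2) by (simp flip: root add: field_simps)
  finally show ?thesis by (simp add: power2_eq_square field_simps)
qed

text \<open>No summand is \<open>-\<infinity>\<close>, so a single infinite one decides the
  sum.\<close>

lemma sum_neg_log:
  "(\<Sum>i\<in>UNIV. neg_log (q $ i))
    = (if \<forall>i. 0 < q $ i then ereal (\<Sum>i\<in>UNIV. - ln (q $ i)) else \<infinity>)"
proof (cases "\<forall>i. 0 < q $ i")
  case True
  then show ?thesis by (simp add: neg_log_def)
next
  case False
  then obtain i where "neg_log (q $ i) = \<infinity>" by (auto simp: neg_log_def)
  then have "(\<Sum>i\<in>UNIV. neg_log (q $ i)) = \<infinity>"
    by (subst sum_Pinfty) auto
  with False show ?thesis by simp
qed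

lemma aug_lagrangian_eq:
  fixes C S Z \<Lambda> :: "real ^ 'm ^ 'm" and q lam :: "real ^ 'm"
  assumes "0 < \<alpha>" and "0 < \<rho>" and "S \<in> S_set"
  defines "Zt \<equiv> C ** S - S ** C + (1 / \<rho>) *\<^sub>R \<Lambda>"
    and "qt \<equiv> S *v 1 - (1 / \<rho>) *\<^sub>R lam"
  shows "aug_lagrangian \<alpha> \<rho> \<delta> C S Z q \<Lambda> lam =
    (if norm Z \<le> \<delta> \<and> (\<forall>i. 0 < q $ i)
     then ereal (frob_inner (\<chi> i j. 1) S - (norm \<Lambda>)\<^sup>2 / (2 * \<rho>) - (norm lam)\<^sup>2 / (2 * \<rho>)
       + \<rho> / 2 * (norm (Z - Zt))\<^sup>2
       + (\<Sum>i\<in>UNIV. \<rho> / 2 * (q $ i - qt $ i)\<^sup>2 - \<alpha> * ln (q $ i)))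
     else \<infinity>)"
proof (cases "norm Z \<le> \<delta> \<and> (\<forall>i. 0 < q $ i)")
  case True
  define A where "A = C ** S - S ** C"
  \<comment> \<open>The residual contains \<open>- Z\<close>, so the multiplier is added in
    \<open>Zt\<close>; \<open>q\<close> enters its residual with a plus sign, so in
    \<open>qt\<close> it is subtracted.\<close>
  have "norm (Z - Zt) = norm ((A - Z) + (1 / \<rho>) *\<^sub>R \<Lambda>)"
    by (subst norm_minus_commute) (simp add: Zt_def A_def algebra_simps)
  then have Z: "\<Lambda> \<bullet> (A - Z) + \<rho> / 2 * (norm (A - Z))\<^sup>2
      = \<rho> / 2 * (norm (Z - Zt))\<^sup>2 - (norm \<Lambda>)\<^sup>2 / (2 * \<rho>)"
    using complete_square[of \<rho> \<Lambda> "A - Z"] assms(2) by simp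
  have "norm (q - qt) = norm ((q - S *v 1) + (1 / \<rho>) *\<^sub>R lam)"
    by (simp add: qt_def algebra_simps)
  then have q: "lam \<bullet> (q - S *v 1) + \<rho> / 2 * (norm (q - S *v 1))\<^sup>2
      = \<rho> / 2 * (norm (q - qt))\<^sup>2 - (norm lam)\<^sup>2 / (2 * \<rho>)"
    using complete_square[of \<rho> lam "q - S *v 1"] assms(2) by simp
  have n: "(norm (q - qt))\<^sup>2 = (\<Sum>i\<in>UNIV. (q $ i - qt $ i)\<^sup>2)"
    by (simp add: norm_vec_def L2_set_def sum_nonneg)
  have "aug_lagrangian \<alpha> \<rho> \<delta> C S Z q \<Lambda> lam = ereal (frob_inner (\<chi> i j. 1) S
      + \<alpha> * (\<Sum>i\<in>UNIV. - ln (q $ i)) + \<Lambda> \<bullet> (A - Z) + lam \<bullet> (q - S *v 1)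
      + \<rho> / 2 * (norm (A - Z))\<^sup>2 + \<rho> / 2 * (norm (q - S *v 1))\<^sup>2)"
    using True assms(3)
    by (simp add: aug_lagrangian_def iota_def sum_neg_log frob_inner_eq_inner A_def)
  also have "\<dots> = ereal (frob_inner (\<chi> i j. 1) S - (norm \<Lambda>)\<^sup>2 / (2 * \<rho>)
      - (norm lam)\<^sup>2 / (2 * \<rho>) + \<rho> / 2 * (norm (Z - Zt))\<^sup>2
      + (\<rho> / 2 * (norm (q - qt))\<^sup>2 + \<alpha> * (\<Sum>i\<in>UNIV. - ln (q $ i))))"
    using Z q by simp
  finally show ?thesis
    using True by (simp add: n sum_subtractf sum_distrib_left sum_negf)
next
  case False
  then show ?thesis
    using assms(1,3) by (auto simp: aug_lagrangian_def iota_def sum_neg_log)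
qed

text \<open>Strict inequality against every other point yields existence and uniqueness
  together.\<close>

lemma is_arg_min_unique:
  fixes f :: "'a \<Rightarrow> 'b::linorder"
  assumes "\<And>x. x \<noteq> a \<Longrightarrow> f a < f x"
  shows "{x. is_arg_min f (\<lambda>_. True) x} = {a}"
  using assms by (force simp: is_arg_min_def dest: less_asym)

theorem proposition5p1:
  fixes \<alpha> \<rho> \<delta> :: real
    and C S \<Lambda> :: "real ^ 'm ^ 'm"
    and lam\<^sub>2 :: "real ^ 'm"
  assumes "0 < \<alpha>" and "0 < \<rho>" and "0 < \<delta>"
    and "transpose C = C"
    and "S \<in> S_set"
  shows
    "let Zt = C ** S - S ** C + (1 / \<rho>) *\<^sub>R \<Lambda>;
         qt = S *v 1 - (1 / \<rho>) *\<^sub>R lam\<^sub>2;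
         Znew = (if Zt = 0 then 1 else min 1 (\<delta> / norm Zt)) *\<^sub>R Zt;
         qnew = (\<chi> i. (qt $ i + sqrt ((qt $ i)\<^sup>2 + 4 * \<alpha> / \<rho>)) / 2)
     in {p. is_arg_min (\<lambda>(Z, q). aug_lagrangian \<alpha> \<rho> \<delta> C S Z q \<Lambda> lam\<^sub>2) (\<lambda>_. True) p}
          = {(Znew, qnew)}"
proof -
  define Zt where "Zt = C ** S - S ** C + (1 / \<rho>) *\<^sub>R \<Lambda>"
  define qt where "qt = S *v 1 - (1 / \<rho>) *\<^sub>R lam\<^sub>2"
  define Zn where "Zn = (if Zt = 0 then 1 else min 1 (\<delta> / norm Zt)) *\<^sub>R Zt"
  define qn :: "real ^ 'm"
    where "qn = (\<chi> i. (qt $ i + sqrt ((qt $ i)\<^sup>2 + 4 * \<alpha> / \<rho>)) / 2)"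
  note L = aug_lagrangian_eq[OF assms(1,2,5), where C = C and \<Lambda> = \<Lambda> and lam = lam\<^sub>2,
      folded Zt_def qt_def]
  have Zn: "norm Zn \<le> \<delta>" unfolding Zn_def using assms(3) by (rule norm_ball_projection)
  have qn: "0 < qn $ i" "\<rho> * (qn $ i * (qn $ i - qt $ i)) = \<alpha>" for i
    using log_prox_root[of "\<alpha> / \<rho>" "qt $ i"] assms(1,2) by (simp_all add: qn_def)
  have "aug_lagrangian \<alpha> \<rho> \<delta> C S Zn qn \<Lambda> lam\<^sub>2 < aug_lagrangian \<alpha> \<rho> \<delta> C S Z q \<Lambda> lam\<^sub>2"
    if ne: "(Z, q) \<noteq> (Zn, qn)" for Z q
  proof (cases "norm Z \<le> \<delta> \<and> (\<forall>i. 0 < q $ i)")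
    case True
    have "(norm (Zn - Zt))\<^sup>2 + (norm (Z - Zn))\<^sup>2 \<le> (norm (Z - Zt))\<^sup>2"
      unfolding Zn_def using assms(3) True by (intro ball_projection_growth) auto
    then have gZ: "\<rho> / 2 * (norm (Zn - Zt))\<^sup>2 + \<rho> / 2 * (norm (Z - Zn))\<^sup>2
        \<le> \<rho> / 2 * (norm (Z - Zt))\<^sup>2"
      using assms(2) by (simp flip: distrib_left)
    have "(\<Sum>i\<in>UNIV. \<rho> / 2 * (qn $ i - qt $ i)\<^sup>2 - \<alpha> * ln (qn $ i) + \<rho> / 2 * (q $ i - qn $ i)\<^sup>2)
        \<le> (\<Sum>i\<in>UNIV. \<rho> / 2 * (q $ i - qt $ i)\<^sup>2 - \<alpha> * ln (q $ i))"
      using True assms(1) qn by (intro sum_mono log_prox_growth) auto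
    then have gq: "(\<Sum>i\<in>UNIV. \<rho> / 2 * (qn $ i - qt $ i)\<^sup>2 - \<alpha> * ln (qn $ i))
        + \<rho> / 2 * (norm (q - qn))\<^sup>2
        \<le> (\<Sum>i\<in>UNIV. \<rho> / 2 * (q $ i - qt $ i)\<^sup>2 - \<alpha> * ln (q $ i))"
      by (simp add: sum.distrib sum_distrib_left norm_vec_def L2_set_def sum_nonneg)
    \<comment> \<open>The pairs differ in some component, so one of the two quadratic gains is
      positive and the comparison becomes strict.\<close>
    have "0 < (norm (Z - Zn))\<^sup>2 + (norm (q - qn))\<^sup>2"
      using ne by (auto simp: sum_power2_gt_zero_iff)
    then have "0 < \<rho> / 2 * ((norm (Z - Zn))\<^sup>2 + (norm (q - qn))\<^sup>2)"
      using assms(2) by (intro mult_pos_pos) auto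
    then have "0 < \<rho> / 2 * (norm (Z - Zn))\<^sup>2 + \<rho> / 2 * (norm (q - qn))\<^sup>2"
      by (simp only: distrib_left)
    with gZ gq True Zn qn(1) show ?thesis by (simp add: L)
  next
    case False
    \<comment> \<open>The value at \<open>(Z, q)\<close> is \<open>\<infinity>\<close>, while
      feasibility of \<open>(Zn, qn)\<close> makes its value finite.\<close>
    with Zn qn(1) show ?thesis by (auto simp: L)
  qed
  then have "{p. is_arg_min (\<lambda>(Z, q). aug_lagrangian \<alpha> \<rho> \<delta> C S Z q \<Lambda> lam\<^sub>2) (\<lambda>_. True) p}
      = {(Zn, qn)}"
    by (intro is_arg_min_unique) auto
  then show ?thesis by (simp add: Let_def Zn_def qn_def Zt_def qt_def)
qed

end
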